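(* Let $B$ be a finite Boolean algebra and $C$ a contact relation on $B$. Then there exist a smallest and a greatest ultracontact $\mathscr K$ on $B$ (with respect to inclusion) such that $\mathrel{C_{\mathscr K}}=C$. In particular, for an ultracontact $\mathscr K$ on $B$: (1) $\mathscr K$ is the smallest ultracontact on $B$ with $\mathrel{C_{\mathscr K}}=C$ iff $\mathscr K\cap 2^{\mathrm{Atom}(B)}_+=\{\{a,b\}\in 2^{\mathrm{Atom}(B)}_+ : a\,C\,b\}$; (2) $\mathscr K$ is the greatest ultracontact on $B$ with $\mathrel{C_{\mathscr K}}=C$ iff $\mathscr K\cap 2^{\mathrm{Atom}(B)}_+=\{H\in 2^{\mathrm{Atom}(B)}_+ : a\,C\,b \text{ for all } a,b\in H\}$.
   Context: Let $B$ be a non-trivial Boolean algebra with operations $+,\cdot$, constants $0,1$ and order $\le$; $\mathrm{Atom}(B)$ is its set of atoms and $2^X_+$ the set of non-empty subsets of $X$ (in $\{a,b\}$, $a=b$ is allowed). For $F,G\subseteq B$ put $F+G=\{f+g: f\in F,\ g\in G\}$, and write $F\preceq G$ iff for every $g\in G$ there is $f\in F$ with $f\le g$. An ultracontact on $B$ is a family $\mathscr K\subseteq 2^B$ such that for all $F,G\subseteq B$: (K0) $\emptyset\notin\mathscr K$; (K1) if $0\in F$ then $F\notin\mathscr K$; (K2) if $x\neq 0$ then $\{x\}\in\mathscr K$; (K3) if $F\preceq G$, $G\neq\emptyset$ and $F\in\mathscr K$, then $G\in\mathscr K$; (K4) if $F+G\in\mathscr K$ then $F\in\mathscr K$ or $G\in\mathscr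 K$. For an ultracontact $\mathscr K$, $x\mathrel{C_{\mathscr K}}y$ iff $\{x,y\}\in\mathscr K$. A contact relation on $B$ is a relation $C\subseteq B\times B$ such that for all $x,y,z$: (C0) not $0\,C\,x$; (C1) $x\neq0$ implies $x\,C\,x$; (C2) $x\,C\,y$ implies $y\,C\,x$; (C3) $x\,C\,y$ and $y\le z$ imply $x\,C\,z$; (C4) $x\,C\,(y+z)$ implies $x\,C\,y$ or $x\,C\,z$. *)

theory Defs
  imports Main "HOL-Library.Lub_Glb"
begin

text \<open>
  The Boolean algebra is a type of class \<^class>\<open>boolean_algebra\<close>: \<open>sup\<close>, \<open>inf\<close>, \<open>bot\<close>, \<open>top\<close>
  are the operations \<open>+\<close>, \<open>\<cdot>\<close> and the constants \<open>0\<close>, \<open>1\<close>. The class also admits the one-element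
  algebra, so non-triviality has to be assumed separately.
\<close>

definition Atoms :: "'a::boolean_algebra set" where
  "Atoms = {a. a \<noteq> bot \<and> (\<forall>x. x \<le> a \<longrightarrow> x = bot \<or> x = a)}"

definition Pow_ne :: "'b set \<Rightarrow> 'b set set" where
  "Pow_ne X = Pow X - {{}}"

definition set_sup :: "'a::boolean_algebra set \<Rightarrow> 'a set \<Rightarrow> 'a set" where
  "set_sup F G = {sup f g | f g. f \<in> F \<and> g \<in> G}"

definition set_prec :: "'a::boolean_algebra set \<Rightarrow> 'a set \<Rightarrow> bool" where
  "set_prec F G \<longleftrightarrow> (\<forall>g\<in>G. \<exists>f\<in>F. f \<le> g)"

locale ultracontact =
  fixes K :: "'a::boolean_algebra set set"
  assumes K0: "{} \<notin> K"
    and K1: "bot \<in> F \<Longrightarrow> F \<notin> K"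
    and K2: "x \<noteq> bot \<Longrightarrow> {x} \<in> K"
    and K3: "set_prec F G \<Longrightarrow> G \<noteq> {} \<Longrightarrow> F \<in> K \<Longrightarrow> G \<in> K"
    and K4: "set_sup F G \<in> K \<Longrightarrow> F \<in> K \<or> G \<in> K"

locale contact =
  fixes C :: "'a::boolean_algebra \<Rightarrow> 'a \<Rightarrow> bool"
  assumes C0: "\<not> C bot x"
    and C1: "x \<noteq> bot \<Longrightarrow> C x x"
    and C2: "C x y \<Longrightarrow> C y x"
    and C3: "C x y \<Longrightarrow> y \<le> z \<Longrightarrow> C x z"
    and C4: "C x (sup y z) \<Longrightarrow> C x y \<or> C x z"

definition contact_of :: "'a::boolean_algebra set set \<Rightarrow> 'a \<Rightarrow> 'a \<Rightarrow> bool" where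
  "contact_of K x y \<longleftrightarrow> {x, y} \<in> K"

definition ultracontact_for :: "('a::boolean_algebra \<Rightarrow> 'a \<Rightarrow> bool) \<Rightarrow> 'a set set \<Rightarrow> bool" where
  "ultracontact_for C K \<longleftrightarrow> ultracontact K \<and> contact_of K = C"

end

theory Submission
  imports Defs
begin

text \<open>
  An ultracontact on a finite Boolean algebra is determined by its sets of atoms: if
  \<open>F \<in> K\<close> contains \<open>x + y\<close>, then \<open>F \<preceq> (F \<union> {x}) + (F \<union> {y})\<close>, so by (K3) and (K4) one of
  \<open>F \<union> {x}\<close>, \<open>F \<union> {y}\<close> is in \<open>K\<close>; a maximal extension of \<open>F\<close> in \<open>K\<close> therefore has an atom below
  each of its elements. Conversely, every family of non-empty sets of atoms that contains the
  singletons and is closed under non-empty subsets arises in this way. A contact relation is likewise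
  determined by its restriction to atoms, so that the ultracontacts inducing \<open>C\<close> correspond to the
  simplicial complexes on the atoms whose edges are given by \<open>C\<close>. The least of these is the graph
  of \<open>C\<close> and the greatest is its clique complex.
\<close>

section \<open>Atoms of a Boolean algebra\<close>

lemma AtomsD: "a \<in> Atoms \<Longrightarrow> x \<le> a \<Longrightarrow> x \<noteq> bot \<Longrightarrow> x = a"
  by (auto simp: Atoms_def)

lemma Atoms_not_bot: "a \<in> Atoms \<Longrightarrow> a \<noteq> bot"
  by (simp add: Atoms_def)

text \<open>An atom that is not below an element is disjoint from it, so by distributivity an atom
  below neither \<open>x\<close> nor \<open>y\<close> is disjoint from
  \<open>sup x y\<close>.\<close>

lemma atom_le_sup:
  assumes "a \<in> Atoms" and "a \<le> sup x y"
  shows "a \<le> x \<or> a \<le> y"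
proof (rule ccontr)
  assume "\<not> (a \<le> x \<or> a \<le> y)"
  then have "inf a x = bot" "inf a y = bot"
    using assms(1) by (metis AtomsD inf.cobounded1 inf.cobounded2)+
  then have "inf a (sup x y) = bot"
    by (simp add: inf_sup_distrib1)
  then show False
    using assms by (simp add: Atoms_not_bot inf.absorb1)
qed

lemma exists_atom_le:
  fixes x :: "'a::{boolean_algebra, finite}"
  assumes "x \<noteq> bot"
  obtains a where "a \<in> Atoms" and "a \<le> x"
proof -
  obtain a where a: "a \<in> {y. y \<noteq> bot \<and> y \<le> x}" "a \<le> x"
    and min: "\<And>b. b \<in> {y. y \<noteq> bot \<and> y \<le> x} \<Longrightarrow> b \<le> a \<Longrightarrow> a = b"
    using finite_has_minimal2[of "{y. y \<noteq> bot \<and> y \<le> x}" x] assms by auto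
  have "a \<in> Atoms"
    unfolding Atoms_def using a min by (auto intro: order_trans)
  with a show thesis using that by blast
qed

section \<open>The preorder \<open>set_prec\<close>\<close>

lemma set_prec_refl: "set_prec F F"
  by (auto simp: set_prec_def)

lemma set_prec_trans: "set_prec F G \<Longrightarrow> set_prec G H \<Longrightarrow> set_prec F H"
  unfolding set_prec_def by (meson order_trans)

lemma set_prec_subset: "G \<subseteq> F \<Longrightarrow> set_prec F G"
  by (auto simp: set_prec_def)

text \<open>Distinct atoms are incomparable, so between sets of atoms \<open>set_prec\<close> is
  just reverse inclusion.\<close>

lemma set_prec_Atoms:
  assumes "H \<subseteq> Atoms" and "G \<subseteq> Atoms" and "set_prec H G"
  shows "G \<subseteq> H"
proof
  fix g assume "g \<in> G"
  then obtain h where "h \<in> H" "h \<le> g"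
    using assms(3) by (auto simp: set_prec_def)
  moreover have "h = g"
    using AtomsD[of g h] Atoms_not_bot[of h] \<open>g \<in> G\<close> \<open>h \<in> H\<close> \<open>h \<le> g\<close> assms(1,2) by blast
  ultimately show "g \<in> H" by simp
qed

section \<open>Contact relations and their restriction to atoms\<close>

lemma contact_atom_left:
  fixes C :: "'a::{boolean_algebra, finite} \<Rightarrow> 'a \<Rightarrow> bool"
  assumes "contact C" and "C x y"
  obtains a where "a \<in> Atoms" and "a \<le> x" and "C a y"
proof -
  interpret contact C by fact
  \<comment> \<open>A minimal \<open>z\<close> below \<open>x\<close> in contact with
    \<open>y\<close> is split into an atom \<open>a\<close> and \<open>z - a\<close>; minimality
    forces the contact onto \<open>a\<close>.\<close>
  obtain z where z: "z \<le> x" "C z y"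
    and min: "\<And>w. C w y \<Longrightarrow> w \<le> z \<Longrightarrow> z = w"
    using finite_has_minimal2[of "{z. C z y}" x] assms(2) by auto
  have "z \<noteq> bot" using z C0 by blast
  then obtain a where a: "a \<in> Atoms" "a \<le> z" by (rule exists_atom_le)
  have "z = sup a (z - a)"
    using a(2) by (simp add: diff_eq sup_inf_distrib1 sup.absorb2)
  then have "C y a \<or> C y (z - a)"
    using z(2) C2 C4 by metis
  moreover have "\<not> C y (z - a)"
  proof
    assume "C y (z - a)"
    then have "z = z - a"
      using C2 min by (simp add: diff_eq)
    then have "a \<le> - a"
      using a(2) by (metis diff_eq inf.boundedE)
    then show False
      using a(1) by (metis Atoms_not_bot inf.absorb1 inf_compl_bot)
  qed
  ultimately show thesis
    using that a z(1) C2 by (meson order_trans)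
qed

lemma contact_iff_atoms:
  fixes C :: "'a::{boolean_algebra, finite} \<Rightarrow> 'a \<Rightarrow> bool"
  assumes "contact C"
  shows "C x y \<longleftrightarrow> (\<exists>a\<in>Atoms. \<exists>b\<in>Atoms. a \<le> x \<and> b \<le> y \<and> C a b)"
proof
  interpret contact C by fact
  show "\<exists>a\<in>Atoms. \<exists>b\<in>Atoms. a \<le> x \<and> b \<le> y \<and> C a b" if "C x y"
  proof -
    obtain a where a: "a \<in> Atoms" "a \<le> x" "C a y"
      using contact_atom_left[OF assms \<open>C x y\<close>] .
    obtain b where "b \<in> Atoms" "b \<le> y" "C b a"
      using contact_atom_left[OF assms C2[OF a(3)]] .
    then show ?thesis
      using a C2 by blast
  qed
  show "C x y" if ex: "\<exists>a\<in>Atoms. \<exists>b\<in>Atoms. a \<le> x \<and> b \<le> y \<and> C a b"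
  proof -
    obtain a b where "a \<le> x" "b \<le> y" "C a b"
      using ex by blast
    then have "C y a"
      using C2 C3 by blast
    then show ?thesis
      using \<open>a \<le> x\<close> C2 C3 by blast
  qed
qed

lemma contact_eqI:
  fixes C D :: "'a::{boolean_algebra, finite} \<Rightarrow> 'a \<Rightarrow> bool"
  assumes "contact C" and "contact D"
    and "\<And>a b. a \<in> Atoms \<Longrightarrow> b \<in> Atoms \<Longrightarrow> C a b \<longleftrightarrow> D a b"
  shows "C = D"
proof (intro ext)
  fix x y
  show "C x y = D x y"
    unfolding contact_iff_atoms[OF assms(1), of x y] contact_iff_atoms[OF assms(2), of x y]
    using assms(3) by blast
qed

lemma contact_contact_of:
  assumes "ultracontact K"
  shows "contact (contact_of K)"
proof -
  interpret ultracontact K by fact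
  show ?thesis
  proof
    show "\<not> contact_of K bot x" for x
      using K1[of "{bot, x}"] by (simp add: contact_of_def)
    show "contact_of K x x" if "x \<noteq> bot" for x
      using K2[OF that] by (simp add: contact_of_def)
    show "contact_of K y x" if "contact_of K x y" for x y
      using that by (simp add: contact_of_def insert_commute)
    show "contact_of K x z" if "contact_of K x y" "y \<le> z" for x y z
    proof -
      have "set_prec {x, y} {x, z}"
        using that(2) by (simp add: set_prec_def)
      then show ?thesis
        using that(1) K3[of "{x, y}" "{x, z}"] by (simp add: contact_of_def)
    qed
    show "contact_of K x y \<or> contact_of K x z" if "contact_of K x (sup y z)" for x y z
    proof -
      \<comment> \<open>The sums are \<open>x\<close>, \<open>sup x z\<close>,
        \<open>sup y x\<close> and \<open>sup y z\<close>: each is above \<open>x\<close> or equal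
        to \<open>sup y z\<close>.\<close>
      have "set_prec {x, sup y z} (set_sup {x, y} {x, z})"
        by (auto simp: set_prec_def set_sup_def)
      moreover have "set_sup {x, y} {x, z} \<noteq> {}"
        by (auto simp: set_sup_def)
      ultimately show ?thesis
        using that K3[of "{x, sup y z}"] K4[of "{x, y}" "{x, z}"] by (simp add: contact_of_def)
    qed
  qed
qed

text \<open>Both \<open>contact_of K\<close> and \<open>C\<close> are contact relations, so it
  suffices to compare them on atoms.\<close>

lemma ultracontact_for_iff:
  fixes C :: "'a::{boolean_algebra, finite} \<Rightarrow> 'a \<Rightarrow> bool"
  assumes "ultracontact K" and "contact C"
  shows "ultracontact_for C K \<longleftrightarrow> (\<forall>a\<in>Atoms. \<forall>b\<in>Atoms. {a, b} \<in> K \<longleftrightarrow> C a b)"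
proof -
  have "contact_of K = C \<longleftrightarrow> (\<forall>a\<in>Atoms. \<forall>b\<in>Atoms. contact_of K a b \<longleftrightarrow> C a b)"
  proof
    assume "\<forall>a\<in>Atoms. \<forall>b\<in>Atoms. contact_of K a b \<longleftrightarrow> C a b"
    then show "contact_of K = C"
      by (intro contact_eqI contact_contact_of assms) blast
  qed simp
  then show ?thesis
    using assms(1) by (simp add: ultracontact_for_def contact_of_def)
qed

section \<open>Ultracontacts and their sets of atoms\<close>

lemma ultracontact_refine:
  fixes K :: "'a::{boolean_algebra, finite} set set"
  assumes "ultracontact K" and "F \<in> K"
  obtains H where "H \<in> K \<inter> Pow_ne Atoms" and "set_prec H F"
proof -
  interpret ultracontact K by fact
  obtain M where M: "F \<subseteq> M" "M \<in> K" and max: "\<And>G. G \<in> K \<Longrightarrow> M \<subseteq> G \<Longrightarrow> M = G"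
    using finite_has_maximal2[of K F] assms(2) by auto
  \<comment> \<open>Maximality makes \<open>M\<close> prime for joins: whichever of
    \<open>insert x M\<close> and \<open>insert y M\<close> lies in \<open>K\<close> must equal
    \<open>M\<close>.\<close>
  have split: "x \<in> M \<or> y \<in> M" if "sup x y \<in> M" for x y
  proof -
    have "set_prec M (set_sup (insert x M) (insert y M))"
      unfolding set_prec_def
    proof
      fix g assume "g \<in> set_sup (insert x M) (insert y M)"
      then obtain u v where "u \<in> insert x M" "v \<in> insert y M" "g = sup u v"
        by (auto simp: set_sup_def)
      then show "\<exists>f\<in>M. f \<le> g"
        using that by (auto intro: sup.cobounded1 sup.cobounded2)
    qed
    moreover have "set_sup (insert x M) (insert y M) \<noteq> {}"
      by (auto simp: set_sup_def)
    ultimately have "insert x M \<in> K \<or> insert y M \<in> K"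
      using K3 K4 M(2) by blast
    then show ?thesis
      using max by (metis insertI1 subset_insertI)
  qed
  have below: "\<exists>a\<in>M \<inter> Atoms. a \<le> f" if f: "f \<in> M" for f
  proof -
    obtain m where m: "m \<in> M" "m \<le> f" and min: "\<And>w. w \<in> M \<Longrightarrow> w \<le> m \<Longrightarrow> m = w"
      using finite_has_minimal2[of M f] f by auto
    have "m \<noteq> bot" using K1 M(2) m(1) by blast
    \<comment> \<open>Primeness puts \<open>x\<close> or \<open>m - x\<close> into \<open>M\<close>,
      and minimality of \<open>m\<close> makes that element equal to \<open>m\<close>. If
      \<open>m = m - x\<close>, then \<open>x\<close> is disjoint from itself.\<close>
    moreover have "x = bot \<or> x = m" if "x \<le> m" for x
    proof -
      have "m = sup x (m - x)"
        using that by (simp add: diff_eq sup_inf_distrib1 sup.absorb2)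
      then have "x \<in> M \<or> m - x \<in> M"
        using split m(1) by metis
      then have "m = x \<or> m = m - x"
        using min that by (auto simp: diff_eq)
      then show ?thesis
      proof
        assume "m = m - x"
        then have "x \<le> - x"
          using that by (metis diff_eq inf.boundedE)
        then show ?thesis
          by (metis inf.absorb1 inf_compl_bot)
      qed simp
    qed
    ultimately show ?thesis
      using m by (auto simp: Atoms_def)
  qed
  then have prec: "set_prec (M \<inter> Atoms) F"
    using M(1) by (auto simp: set_prec_def)
  have "M \<inter> Atoms \<noteq> {}"
    using below M(2) K0 by (metis empty_iff equals0I)
  moreover from this have "M \<inter> Atoms \<in> K"
    using K3[OF set_prec_subset _ M(2)] by blast
  ultimately show thesis
    using that[of "M \<inter> Atoms"] prec by (simp add: Pow_ne_def)
qed

text \<open>Each \<open>F\<close> in \<open>K\<close> is refined by a set of atoms in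
  \<open>K\<close>; once that set is in \<open>L\<close>, (K3) for \<open>L\<close> brings
  \<open>F\<close> back.\<close>

lemma ultracontact_subset_iff:
  fixes K L :: "'a::{boolean_algebra, finite} set set"
  assumes "ultracontact K" and "ultracontact L"
  shows "K \<subseteq> L \<longleftrightarrow> K \<inter> Pow_ne Atoms \<subseteq> L \<inter> Pow_ne Atoms"
proof
  assume trace: "K \<inter> Pow_ne Atoms \<subseteq> L \<inter> Pow_ne Atoms"
  show "K \<subseteq> L"
  proof
    fix F assume "F \<in> K"
    then obtain H where "H \<in> K \<inter> Pow_ne Atoms" "set_prec H F"
      using ultracontact_refine assms(1) by blast
    moreover have "F \<noteq> {}"
      using \<open>F \<in> K\<close> ultracontact.K0[OF assms(1)] by blast
    ultimately show "F \<in> L"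
      using trace ultracontact.K3[OF assms(2)] by blast
  qed
qed blast

lemma ultracontact_eq_iff:
  fixes K L :: "'a::{boolean_algebra, finite} set set"
  assumes "ultracontact K" and "ultracontact L"
  shows "K = L \<longleftrightarrow> K \<inter> Pow_ne Atoms = L \<inter> Pow_ne Atoms"
  using ultracontact_subset_iff[OF assms] ultracontact_subset_iff[OF assms(2,1)] by blast

section \<open>Ultracontacts generated by families of sets of atoms\<close>

definition generated :: "'a::boolean_algebra set set \<Rightarrow> 'a set set" where
  "generated \<A> = {F. F \<noteq> {} \<and> (\<exists>H\<in>\<A>. set_prec H F)}"

text \<open>The singletons in \<A> yield (K2), and (K4) rests on \<open>atom_le_sup\<close>; closing
  upwards under \<open>set_prec\<close> yields (K3).\<close>

lemma ultracontact_generated: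
  fixes \<A> :: "'a::{boolean_algebra, finite} set set"
  assumes sub: "\<A> \<subseteq> Pow_ne Atoms"
    and sing: "\<And>a. a \<in> Atoms \<Longrightarrow> {a} \<in> \<A>"
  shows "ultracontact (generated \<A>)"
proof
  show "{} \<notin> generated \<A>"
    by (simp add: generated_def)
  show "F \<notin> generated \<A>" if bot: "bot \<in> F" for F
  proof
    assume "F \<in> generated \<A>"
    then obtain H h where "H \<in> \<A>" "h \<in> H" "h \<le> bot"
      using bot unfolding generated_def set_prec_def by blast
    then show False
      using sub Atoms_not_bot[of h] by (auto simp: Pow_ne_def bot_unique)
  qed
  show "{x} \<in> generated \<A>" if nz: "x \<noteq> bot" for x
  proof -
    obtain a where "a \<in> Atoms" "a \<le> x"
      using nz by (rule exists_atom_le)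
    then have "{a} \<in> \<A>" "set_prec {a} {x}"
      using sing by (auto simp: set_prec_def)
    then show ?thesis by (auto simp: generated_def)
  qed
  show "G \<in> generated \<A>" if "set_prec F G" "G \<noteq> {}" "F \<in> generated \<A>" for F G
    using that set_prec_trans unfolding generated_def by blast
  show "F \<in> generated \<A> \<or> G \<in> generated \<A>" if sup: "set_sup F G \<in> generated \<A>" for F G
  proof -
    obtain H where H: "H \<in> \<A>" "set_prec H (set_sup F G)" and "set_sup F G \<noteq> {}"
      using sup by (auto simp: generated_def)
    then have ne: "F \<noteq> {}" "G \<noteq> {}"
      by (auto simp: set_sup_def)
    \<comment> \<open>The same \<open>H\<close> serves one of the two sets: if \<open>f\<close> and
      \<open>g\<close> witness failure for both, some atom of \<open>H\<close> is below
      \<open>sup f g\<close>, hence below \<open>f\<close> or \<open>g\<close>.\<close>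
    have "set_prec H F \<or> set_prec H G"
    proof (rule ccontr)
      assume "\<not> (set_prec H F \<or> set_prec H G)"
      then obtain f g where fg: "f \<in> F" "g \<in> G" "\<And>h. h \<in> H \<Longrightarrow> \<not> h \<le> f" "\<And>h. h \<in> H \<Longrightarrow> \<not> h \<le> g"
        by (auto simp: set_prec_def)
      then have "sup f g \<in> set_sup F G"
        by (auto simp: set_sup_def)
      then obtain h where "h \<in> H" "h \<le> sup f g"
        using H(2) by (auto simp: set_prec_def)
      moreover have "h \<in> Atoms"
        using \<open>h \<in> H\<close> H(1) sub by (auto simp: Pow_ne_def)
      ultimately show False
        using atom_le_sup fg(3,4) by blast
    qed
    then show ?thesis
      using H(1) ne by (auto simp: generated_def)
  qed
qed

text \<open>The only sets of atoms added by closing upwards are non-empty subsets of members, and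
  \<A> already contains these.\<close>

lemma generated_trace:
  assumes sub: "\<A> \<subseteq> Pow_ne Atoms"
    and down: "\<And>G H. H \<in> \<A> \<Longrightarrow> G \<subseteq> H \<Longrightarrow> G \<noteq> {} \<Longrightarrow> G \<in> \<A>"
  shows "generated \<A> \<inter> Pow_ne Atoms = \<A>"
proof
  show "generated \<A> \<inter> Pow_ne Atoms \<subseteq> \<A>"
  proof
    fix F assume "F \<in> generated \<A> \<inter> Pow_ne Atoms"
    then obtain H where H: "H \<in> \<A>" "set_prec H F" "F \<subseteq> Atoms" "F \<noteq> {}"
      by (auto simp: generated_def Pow_ne_def)
    then have "F \<subseteq> H"
      using set_prec_Atoms sub unfolding Pow_ne_def by blast
    then show "F \<in> \<A>"
      using H down by blast
  qed
  show "\<A> \<subseteq> generated \<A> \<inter> Pow_ne Atoms"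
    using sub set_prec_refl by (auto simp: generated_def Pow_ne_def)
qed

section \<open>Least and greatest ultracontacts inducing a contact relation\<close>

lemma leastP_eq_iff:
  assumes "leastP P K"
  shows "leastP P L \<longleftrightarrow> L = (K::'b::order)"
proof
  assume "leastP P L"
  then have "L \<le> K" "K \<le> L"
    using assms by (simp_all add: leastP_def setge_def)
  then show "L = K" by (rule antisym)
qed (use assms in simp)

lemma greatestP_eq_iff:
  assumes "greatestP P K"
  shows "greatestP P L \<longleftrightarrow> L = (K::'b::order)"
proof
  assume "greatestP P L"
  then have "L \<le> K" "K \<le> L"
    using assms by (simp_all add: greatestP_def setle_def)
  then show "L = K" by (rule antisym)
qed (use assms in simp)

theorem theorem7p9:
  fixes C :: "'a::{boolean_algebra, finite} \<Rightarrow> 'a \<Rightarrow> bool"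
  assumes nontrivial: "(bot::'a) \<noteq> top"
    and contact: "contact C"
  shows "(\<exists>K. leastP (ultracontact_for C) K) \<and>
         (\<exists>K. greatestP (ultracontact_for C) K) \<and>
         (\<forall>K. ultracontact K \<longrightarrow>
           (leastP (ultracontact_for C) K \<longleftrightarrow>
              K \<inter> Pow_ne Atoms = {{a, b} | a b. {a, b} \<in> Pow_ne Atoms \<and> C a b}) \<and>
           (greatestP (ultracontact_for C) K \<longleftrightarrow>
              K \<inter> Pow_ne Atoms = {H \<in> Pow_ne Atoms. \<forall>a\<in>H. \<forall>b\<in>H. C a b}))"
proof -
  interpret contact C by fact
  \<comment> \<open>\<P> consists of the vertices and edges of the graph of \<open>C\<close> on the
    atoms, and \<Q> of its non-empty cliques.\<close>
  define \<P> where "\<P> = {{a, b} | a b. {a, b} \<in> Pow_ne Atoms \<and> C a b}"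
  define \<Q> where "\<Q> = {H \<in> Pow_ne Atoms. \<forall>a\<in>H. \<forall>b\<in>H. C a b}"
  have atom: "C a a" if "a \<in> Atoms" for a
    using that by (simp add: Atoms_not_bot C1)
  have sym: "C a b \<longleftrightarrow> C b a" for a b
    using C2 by blast
  \<comment> \<open>Symmetry is essential here: the set may be listed in \<P> as
    \<open>{b, a}\<close>.\<close>
  have pair_P: "{a, b} \<in> \<P> \<longleftrightarrow> C a b" if "a \<in> Atoms" "b \<in> Atoms" for a b
    using that sym[of a b] by (auto simp: \<P>_def Pow_ne_def doubleton_eq_iff)
  have pair_Q: "{a, b} \<in> \<Q> \<longleftrightarrow> C a b" if "a \<in> Atoms" "b \<in> Atoms" for a b
    using that sym[of a b] atom by (auto simp: \<Q>_def Pow_ne_def)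
  have sub: "\<P> \<subseteq> Pow_ne Atoms" "\<Q> \<subseteq> Pow_ne Atoms"
    by (auto simp: \<P>_def \<Q>_def)
  have sing: "{a} \<in> \<P>" "{a} \<in> \<Q>" if "a \<in> Atoms" for a
    using pair_P[OF that that] pair_Q[OF that that] atom[OF that] by simp_all
  have down_P: "G \<in> \<P>" if H: "H \<in> \<P>" and G: "G \<subseteq> H" "G \<noteq> {}" for G H
  proof -
    obtain a b where "H = {a, b}" "a \<in> Atoms" "b \<in> Atoms"
      using H unfolding \<P>_def Pow_ne_def by blast
    moreover from this have "G = {a} \<or> G = {b} \<or> G = H"
      using G by blast
    ultimately show ?thesis
      using H sing(1) by auto
  qed
  have down_Q: "G \<in> \<Q>" if "H \<in> \<Q>" "G \<subseteq> H" "G \<noteq> {}" for G H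
    using that by (auto simp: \<Q>_def Pow_ne_def)
  have uP: "ultracontact (generated \<P>)" and uQ: "ultracontact (generated \<Q>)"
    using ultracontact_generated[OF sub(1)] ultracontact_generated[OF sub(2)] sing by simp_all
  have tP: "generated \<P> \<inter> Pow_ne Atoms = \<P>"
    using sub(1) down_P by (rule generated_trace)
  have tQ: "generated \<Q> \<inter> Pow_ne Atoms = \<Q>"
    using sub(2) down_Q by (rule generated_trace)
  have Pow_pair: "{a, b} \<in> Pow_ne Atoms" if "a \<in> Atoms" "b \<in> Atoms" for a b :: 'a
    using that by (simp add: Pow_ne_def)
  have fP: "ultracontact_for C (generated \<P>)"
    unfolding ultracontact_for_iff[OF uP contact] using tP pair_P Pow_pair by blast
  have fQ: "ultracontact_for C (generated \<Q>)"
    unfolding ultracontact_for_iff[OF uQ contact] using tQ pair_Q Pow_pair by blast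
  \<comment> \<open>Inducing \<open>C\<close> forces the edges into \<open>K\<close>. Conversely, by
    (K3) a set of atoms in \<open>K\<close> has all its pairs in \<open>K\<close>, so it is a
    clique.\<close>
  have bounds: "generated \<P> \<subseteq> K \<and> K \<subseteq> generated \<Q>" if "ultracontact_for C K" for K
  proof -
    have uK: "ultracontact K"
      using that by (simp add: ultracontact_for_def)
    interpret K: ultracontact K by fact
    have pair: "{a, b} \<in> K \<longleftrightarrow> C a b" if "a \<in> Atoms" "b \<in> Atoms" for a b
      using \<open>ultracontact_for C K\<close> that unfolding ultracontact_for_iff[OF uK contact] by blast
    have "\<P> \<subseteq> K"
      using pair by (auto simp: \<P>_def Pow_ne_def)
    moreover have "K \<inter> Pow_ne Atoms \<subseteq> \<Q>"
    proof
      fix H assume H: "H \<in> K \<inter> Pow_ne Atoms"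
      have "C a b" if "a \<in> H" "b \<in> H" for a b
      proof -
        have "{a, b} \<in> K"
          using K.K3[OF set_prec_subset[of "{a, b}" H]] that H by blast
        then show ?thesis
          using pair that H by (auto simp: Pow_ne_def)
      qed
      then show "H \<in> \<Q>"
        using H by (simp add: \<Q>_def)
    qed
    ultimately show ?thesis
      unfolding ultracontact_subset_iff[OF uP uK] ultracontact_subset_iff[OF uK uQ] tP tQ
      using sub by blast
  qed
  have least: "leastP (ultracontact_for C) (generated \<P>)"
    using fP bounds by (auto simp: leastP_def setge_def)
  have greatest: "greatestP (ultracontact_for C) (generated \<Q>)"
    using fQ bounds by (auto simp: greatestP_def setle_def)
  \<comment> \<open>Least and greatest elements are unique, so both claims become equality with a
    generated ultracontact, which is decided by the sets of atoms.\<close>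
  have "leastP (ultracontact_for C) K \<longleftrightarrow> K \<inter> Pow_ne Atoms = \<P>"
    "greatestP (ultracontact_for C) K \<longleftrightarrow> K \<inter> Pow_ne Atoms = \<Q>" if "ultracontact K" for K
    using leastP_eq_iff[OF least] greatestP_eq_iff[OF greatest]
      ultracontact_eq_iff[OF that uP] ultracontact_eq_iff[OF that uQ] tP tQ by simp_all
  then show ?thesis
    unfolding \<P>_def[symmetric] \<Q>_def[symmetric] using least greatest by auto
qed

end
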